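(* Let $(S,\Sigma,\mathcal{M})$ be a continuous statistical model, $X$ a finite sample over $(S,\Sigma)$ and $\epsilon$ an estimand of $\mathcal{M}$ over $X$. Then there exists a unique coarsest topology $\mathcal{T}$ over $\mathcal{M}$ that makes $\epsilon$ continuous.
   Context: A statistical model is a triple $(S,\Sigma,\mathcal{M})$, where $(S,\Sigma)$ is a measurable space (the sample space) and $\mathcal{M}$ is a set of probability distributions over $(S,\Sigma)$. It is continuous iff $(S,\Sigma)$ is a Borel space and all $P\in\mathcal{M}$ are absolutely continuous over $(S,\Sigma)$, so that $\mathcal{M}$ embeds into $L^1(S,\Sigma)$ via densities. Let $X$ be a finite random sample in $S$ of length $n$, generating the $\sigma$-algebra $\mathcal{A}^n$. A (continuous) estimand of $\mathcal{M}$ over $X$ is a mapping $\epsilon\colon\mathcal{M}\times\mathcal{A}^n\to\mathbb{R}$ which is (i) $L^1$-continuous in its first argument and (ii) $\mathcal{A}^n$-symmetric in its second argument (invariant under permutations of $A=\{A_i\}$). One writes $\epsilon(P\mid A)=\epsilon(P,A)$ for the value and $\epsilon(P\mid X)$ for the function $A\mapsto\epsilon(P\mid A)$, which is regarded as an element of an $L^1$-space $L^1_X(S,\Sigma)$: the smallest Bochner space containing $L^1(S,\Sigma)$ and the empirical distributions of $X$, with the extended $L_1$-distance. Continuity of $\epsilon$ with respect to a topology on $\mathcal{M}$ refers to the first argument, i.e. to the operator $P\mapsto\epsilon(P\mid X)$. *)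

theory Defs
  imports "HOL-Probability.Probability"
begin

section \<open>Statistical models\<close>

text \<open>
  A measurable space \<open>(S, \<Sigma>)\<close> is given as a measure \<open>S\<close> of which only \<open>space S\<close> and \<open>sets S\<close>
  are used.
\<close>

definition statistical_model :: "'a measure \<Rightarrow> 'a measure set \<Rightarrow> bool" where
  "statistical_model S \<M> \<longleftrightarrow> (\<forall>P\<in>\<M>. prob_space P \<and> sets P = sets S)"

text \<open>No separability or completeness is required, so standard Borel spaces are included.\<close>

definition borel_measurable_space :: "'a measure \<Rightarrow> bool" where
  "borel_measurable_space S \<longleftrightarrow>
     (\<exists>T. topspace T = space S \<and> sets S = sigma_sets (space S) {U. openin T U})"

text \<open>
  Absolute continuity and densities refer to a \<open>\<sigma>\<close>-finite reference measure \<open>\<mu>\<close> on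
  \<open>(S, \<Sigma>)\<close>, for example Lebesgue measure; \<open>L\<^sup>1(S, \<Sigma>)\<close> is taken with respect to \<open>\<mu>\<close>.
\<close>

definition continuous_model :: "'a measure \<Rightarrow> 'a measure \<Rightarrow> 'a measure set \<Rightarrow> bool" where
  "continuous_model S \<mu> \<M> \<longleftrightarrow>
     statistical_model S \<M> \<and> borel_measurable_space S \<and>
     sigma_finite_measure \<mu> \<and> sets \<mu> = sets S \<and>
     (\<forall>P\<in>\<M>. absolutely_continuous \<mu> P)"

definition L1_dist :: "'a measure \<Rightarrow> 'a measure \<Rightarrow> 'a measure \<Rightarrow> real" where
  "L1_dist \<mu> P Q = (\<integral>x. \<bar>enn2real (RN_deriv \<mu> P x) - enn2real (RN_deriv \<mu> Q x)\<bar> \<partial>\<mu>)"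

definition L1_topology :: "'a measure \<Rightarrow> 'a measure set \<Rightarrow> 'a measure topology" where
  "L1_topology \<mu> \<M> = Metric_space.mtopology \<M> (L1_dist \<mu>)"

lemma Metric_space_L1_dist:
  assumes "continuous_model S \<mu> \<M>"
  shows "Metric_space \<M> (L1_dist \<mu>)"
proof -
  interpret sigma_finite_measure \<mu> using assms by (simp add: continuous_model_def)
  define r where "r P x = enn2real (RN_deriv \<mu> P x)" for P x
  have M: "prob_space P" "sets P = sets \<mu>" "absolutely_continuous \<mu> P" if "P \<in> \<M>" for P
    using assms that by (auto simp: continuous_model_def statistical_model_def)
  have dens: "density \<mu> (RN_deriv \<mu> P) = P" if "P \<in> \<M>" for P
    using density_RN_deriv M[OF that] by blast
  have nn: "(\<integral>\<^sup>+x. RN_deriv \<mu> P x \<partial>\<mu>) = 1" if P: "P \<in> \<M>" for P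
  proof -
    have "emeasure (density \<mu> (RN_deriv \<mu> P)) (space \<mu>) = 1"
      using M[OF P] prob_space.emeasure_space_1[of P] sets_eq_imp_space_eq[of P \<mu>] dens[OF P] by simp
    then show ?thesis by (simp add: emeasure_density cong: nn_integral_cong)
  qed
  have fin: "AE x in \<mu>. RN_deriv \<mu> P x = ennreal (r P x)" if P: "P \<in> \<M>" for P
  proof -
    have "AE x in \<mu>. RN_deriv \<mu> P x \<noteq> \<infinity>"
      using nn[OF P] by (intro nn_integral_PInf_AE) auto
    then show ?thesis by eventually_elim (auto simp: r_def top.not_eq_extremum)
  qed
  have int: "integrable \<mu> (r P)" if P: "P \<in> \<M>" for P
  proof (rule integrableI_nonneg)
    show "r P \<in> borel_measurable \<mu>" by (simp add: r_def[abs_def])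
    show "AE x in \<mu>. 0 \<le> r P x" by (simp add: r_def)
    have "(\<integral>\<^sup>+x. ennreal (r P x) \<partial>\<mu>) = (\<integral>\<^sup>+x. RN_deriv \<mu> P x \<partial>\<mu>)"
      using fin[OF P] by (intro nn_integral_cong_AE) auto
    then show "(\<integral>\<^sup>+x. ennreal (r P x) \<partial>\<mu>) < \<infinity>" using nn[OF P] by simp
  qed
  have d: "L1_dist \<mu> P Q = (\<integral>x. \<bar>r P x - r Q x\<bar> \<partial>\<mu>)" for P Q
    by (simp add: L1_dist_def r_def)
  show ?thesis
  proof
    show "0 \<le> L1_dist \<mu> P Q" for P Q by (simp add: d)
    show "L1_dist \<mu> P Q = L1_dist \<mu> Q P" for P Q by (simp add: d abs_minus_commute)
    show "(L1_dist \<mu> P Q = 0) = (P = Q)" if PQ: "P \<in> \<M>" "Q \<in> \<M>" for P Q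
    proof
      assume "L1_dist \<mu> P Q = 0"
      then have "AE x in \<mu>. \<bar>r P x - r Q x\<bar> = 0"
        using int[OF PQ(1)] int[OF PQ(2)]
        by (subst integral_nonneg_eq_0_iff_AE[symmetric]) (auto simp: d)
      then have "AE x in \<mu>. RN_deriv \<mu> P x = RN_deriv \<mu> Q x"
        using fin[OF PQ(1)] fin[OF PQ(2)] by eventually_elim auto
      then have "density \<mu> (RN_deriv \<mu> P) = density \<mu> (RN_deriv \<mu> Q)"
        by (intro density_cong) auto
      then show "P = Q" using dens PQ by simp
    qed (simp add: d)
    show "L1_dist \<mu> P R \<le> L1_dist \<mu> P Q + L1_dist \<mu> Q R" if "P \<in> \<M>" "Q \<in> \<M>" "R \<in> \<M>" for P Q R
    proof -
      have i: "integrable \<mu> (\<lambda>x. \<bar>r A x - r B x\<bar>)" if "A \<in> \<M>" "B \<in> \<M>" for A B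
        using int[OF that(1)] int[OF that(2)] by auto
      have "L1_dist \<mu> P R \<le> (\<integral>x. \<bar>r P x - r Q x\<bar> + \<bar>r Q x - r R x\<bar> \<partial>\<mu>)"
        unfolding d by (rule integral_mono) (use i that in auto)
      also have "\<dots> = L1_dist \<mu> P Q + L1_dist \<mu> Q R"
        unfolding d by (rule Bochner_Integration.integral_add) (use i that in auto)
      finally show ?thesis .
    qed
  qed
qed


section \<open>Samples and estimands\<close>

text \<open>
  The sample points are defined on a probability space \<open>\<Omega>\<close>. Their joint law is arbitrary; the
  i.i.d. case is included.
\<close>

definition finite_sample :: "'a measure \<Rightarrow> 'w measure \<Rightarrow> nat \<Rightarrow> (nat \<Rightarrow> 'w \<Rightarrow> 'a) \<Rightarrow> bool" where
  "finite_sample S \<Omega> n X \<longleftrightarrow> prob_space \<Omega> \<and> 0 < n \<and> (\<forall>i<n. X i \<in> measurable \<Omega> S)"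

definition sample_vector :: "nat \<Rightarrow> (nat \<Rightarrow> 'w \<Rightarrow> 'a) \<Rightarrow> 'w \<Rightarrow> nat \<Rightarrow> 'a" where
  "sample_vector n X \<omega> = (\<lambda>i\<in>{..<n}. X i \<omega>)"

definition sample_event ::
  "'w measure \<Rightarrow> nat \<Rightarrow> (nat \<Rightarrow> 'w \<Rightarrow> 'a) \<Rightarrow> (nat \<Rightarrow> 'a) set \<Rightarrow> 'w set" where
  "sample_event \<Omega> n X B = {\<omega> \<in> space \<Omega>. sample_vector n X \<omega> \<in> B}"

text \<open>The \<open>\<sigma>\<close>-algebra \<open>\<A>\<^sup>n\<close> generated by the sample.\<close>

definition sample_algebra ::
  "'a measure \<Rightarrow> 'w measure \<Rightarrow> nat \<Rightarrow> (nat \<Rightarrow> 'w \<Rightarrow> 'a) \<Rightarrow> 'w set set" where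
  "sample_algebra S \<Omega> n X =
     sets (vimage_algebra (space \<Omega>) (sample_vector n X) (Pi\<^sub>M {..<n} (\<lambda>_. S)))"

text \<open>
  For a rectangle \<open>B = (\<Pi> i. B\<^sub>i)\<close> the event \<open>sample_event \<Omega> n X B\<close> is the intersection of the
  events \<open>A\<^sub>i = {X\<^sub>i \<in> B\<^sub>i}\<close>, and replacing \<open>X\<close> by \<open>X \<circ> p\<close> permutes the sample points in these
  events. Symmetry is required for all events of \<open>\<A>\<^sup>n\<close>, in this form because the action
  of \<open>p\<close> depends on the choice of \<open>B\<close> and not only on the event.
\<close>

definition sample_symmetric ::
  "'a measure \<Rightarrow> 'w measure \<Rightarrow> nat \<Rightarrow> (nat \<Rightarrow> 'w \<Rightarrow> 'a) \<Rightarrow> ('w set \<Rightarrow> real) \<Rightarrow> bool" where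
  "sample_symmetric S \<Omega> n X \<phi> \<longleftrightarrow>
     (\<forall>p B. p permutes {..<n} \<longrightarrow> B \<in> sets (Pi\<^sub>M {..<n} (\<lambda>_. S)) \<longrightarrow>
        \<phi> (sample_event \<Omega> n (X \<circ> p) B) = \<phi> (sample_event \<Omega> n X B))"

definition estimand ::
  "'a measure \<Rightarrow> 'a measure \<Rightarrow> 'a measure set \<Rightarrow> 'w measure \<Rightarrow> nat \<Rightarrow> (nat \<Rightarrow> 'w \<Rightarrow> 'a) \<Rightarrow>
   ('a measure \<Rightarrow> 'w set \<Rightarrow> real) \<Rightarrow> bool" where
  "estimand S \<mu> \<M> \<Omega> n X \<epsilon> \<longleftrightarrow>
     (\<forall>A \<in> sample_algebra S \<Omega> n X.
        continuous_map (L1_topology \<mu> \<M>) euclidean (\<lambda>P. \<epsilon> P A)) \<and>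
     (\<forall>P\<in>\<M>. sample_symmetric S \<Omega> n X (\<epsilon> P))"

text \<open>The function \<open>\<epsilon>(P | X)\<close> on \<open>\<A>\<^sup>n\<close>; values outside \<open>\<A>\<^sup>n\<close> are discarded.\<close>

definition estimand_fun ::
  "'a measure \<Rightarrow> 'w measure \<Rightarrow> nat \<Rightarrow> (nat \<Rightarrow> 'w \<Rightarrow> 'a) \<Rightarrow>
   ('a measure \<Rightarrow> 'w set \<Rightarrow> real) \<Rightarrow> 'a measure \<Rightarrow> 'w set \<Rightarrow> real" where
  "estimand_fun S \<Omega> n X \<epsilon> P = restrict (\<epsilon> P) (sample_algebra S \<Omega> n X)"


section \<open>The space \<open>L\<^sup>1\<^sub>X(S, \<Sigma>)\<close>\<close>

text \<open>
  Densities and empirical distributions have a common home in the space of finite signed measures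
  on \<open>(S, \<Sigma>)\<close>, on which the total variation distance extends the \<open>L\<^sup>1\<close>-distance of densities.
  By the Jordan decomposition, finite signed measures are differences of finite measures.
\<close>

definition signed_measures :: "'a measure \<Rightarrow> ('a set \<Rightarrow> real) set" where
  "signed_measures S =
     {restrict (\<lambda>A. measure N\<^sub>1 A - measure N\<^sub>2 A) (sets S) | N\<^sub>1 N\<^sub>2.
        finite_measure N\<^sub>1 \<and> finite_measure N\<^sub>2 \<and> sets N\<^sub>1 = sets S \<and> sets N\<^sub>2 = sets S}"

definition tv_dist :: "'a measure \<Rightarrow> ('a set \<Rightarrow> real) \<Rightarrow> ('a set \<Rightarrow> real) \<Rightarrow> real" where
  "tv_dist S \<nu> \<rho> =
     enn2real (SUP \<D> \<in> {\<D>. finite \<D> \<and> \<D> \<subseteq> sets S \<and> disjoint \<D>}.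
       ennreal (\<Sum>A\<in>\<D>. \<bar>\<nu> A - \<rho> A\<bar>))"

definition signed_measure_abs_cont :: "'a measure \<Rightarrow> ('a set \<Rightarrow> real) \<Rightarrow> ('a set \<Rightarrow> real) \<Rightarrow> bool" where
  "signed_measure_abs_cont S \<rho> \<nu> \<longleftrightarrow>
     (\<forall>A\<in>sets S. (\<forall>B\<in>sets S. B \<subseteq> A \<longrightarrow> \<nu> B = 0) \<longrightarrow> \<rho> A = 0)"

text \<open>
  The \<open>L\<^sup>1\<close>-spaces among the spaces of signed measures are the linear subspaces that are closed in
  total variation and contain, with a signed measure \<open>\<nu>\<close>, everything absolutely continuous with
  respect to \<open>\<nu>\<close> (that is, all \<open>f \<cdot> \<bar>\<nu>\<bar>\<close> with \<open>f\<close> Bochner integrable with respect to \<open>\<bar>\<nu>\<bar>\<close>).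
  In particular, the smallest such space over \<open>L\<^sup>1(S, \<Sigma>, \<mu>)\<close> and finitely many point masses at
  \<open>x\<^sub>1, \<dots>, x\<^sub>k\<close> is \<open>L\<^sup>1(S, \<Sigma>, \<mu> + \<delta>\<^sub>x\<^sub>1 + \<dots> + \<delta>\<^sub>x\<^sub>k)\<close>.
\<close>

definition L1_subspace :: "'a measure \<Rightarrow> ('a set \<Rightarrow> real) set \<Rightarrow> bool" where
  "L1_subspace S V \<longleftrightarrow>
     V \<subseteq> signed_measures S \<and>
     (\<lambda>A\<in>sets S. 0) \<in> V \<and>
     (\<forall>\<nu>\<in>V. \<forall>\<rho>\<in>V. (\<lambda>A\<in>sets S. \<nu> A + \<rho> A) \<in> V) \<and>
     (\<forall>c. \<forall>\<nu>\<in>V. (\<lambda>A\<in>sets S. c * \<nu> A) \<in> V) \<and>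
     (\<forall>\<nu>\<in>V. \<forall>\<rho>\<in>signed_measures S. signed_measure_abs_cont S \<rho> \<nu> \<longrightarrow> \<rho> \<in> V) \<and>
     (\<forall>\<rho>\<in>signed_measures S. (\<forall>e>0. \<exists>\<nu>\<in>V. tv_dist S \<rho> \<nu> < e) \<longrightarrow> \<rho> \<in> V)"

definition L1_space :: "'a measure \<Rightarrow> ('a set \<Rightarrow> real) set" where
  "L1_space \<mu> =
     {restrict (\<lambda>A. set_lebesgue_integral \<mu> A f) (sets \<mu>) | f. integrable \<mu> f}"

definition empirical_distribution ::
  "'a measure \<Rightarrow> nat \<Rightarrow> (nat \<Rightarrow> 'w \<Rightarrow> 'a) \<Rightarrow> 'w \<Rightarrow> 'a set \<Rightarrow> real" where
  "empirical_distribution S n X \<omega> =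
     (\<lambda>A\<in>sets S. real (card {i\<in>{..<n}. X i \<omega> \<in> A}) / real n)"

definition L1_X ::
  "'a measure \<Rightarrow> 'a measure \<Rightarrow> 'w measure \<Rightarrow> nat \<Rightarrow> (nat \<Rightarrow> 'w \<Rightarrow> 'a) \<Rightarrow> ('a set \<Rightarrow> real) set" where
  "L1_X S \<mu> \<Omega> n X =
     \<Inter>{V. L1_subspace S V \<and> L1_space \<mu> \<subseteq> V \<and>
            empirical_distribution S n X ` space \<Omega> \<subseteq> V}"

definition L1_X_topology ::
  "'a measure \<Rightarrow> 'a measure \<Rightarrow> 'w measure \<Rightarrow> nat \<Rightarrow> (nat \<Rightarrow> 'w \<Rightarrow> 'a) \<Rightarrow> ('a set \<Rightarrow> real) topology" where
  "L1_X_topology S \<mu> \<Omega> n X = Metric_space.mtopology (L1_X S \<mu> \<Omega> n X) (tv_dist S)"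

lemma signed_measures_tv_bounded:
  assumes "\<nu> \<in> signed_measures S" "\<rho> \<in> signed_measures S"
  shows "bdd_above ((\<lambda>\<D>. \<Sum>A\<in>\<D>. \<bar>\<nu> A - \<rho> A\<bar>) ` {\<D>. finite \<D> \<and> \<D> \<subseteq> sets S \<and> disjoint \<D>})"
proof -
  have bound: "(\<Sum>A\<in>\<D>. measure N A) \<le> measure N (space N)"
    if "finite_measure N" "sets N = sets S" "finite \<D>" "\<D> \<subseteq> sets S" "disjoint \<D>" for N \<D>
  proof -
    interpret finite_measure N by fact
    have "(\<Sum>A\<in>\<D>. measure N A) = measure N (\<Union>A\<in>\<D>. A)"
    proof (rule finite_measure_finite_Union[symmetric])
      show "(\<lambda>A. A) ` \<D> \<subseteq> sets N" unfolding that(2) image_ident by (rule that(4))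
      show "disjoint_family_on (\<lambda>A. A) \<D>"
        unfolding disjoint_family_on_def using disjointD[OF that(5)] by blast
    qed (rule that(3))
    also have "\<dots> \<le> measure N (space N)" by (rule bounded_measure)
    finally show ?thesis .
  qed
  have one: "\<exists>C. \<forall>\<D>. finite \<D> \<and> \<D> \<subseteq> sets S \<and> disjoint \<D> \<longrightarrow> (\<Sum>A\<in>\<D>. \<bar>\<nu> A\<bar>) \<le> C"
    if \<nu>: "\<nu> \<in> signed_measures S" for \<nu>
  proof -
    obtain N1 N2 where N: "\<nu> = restrict (\<lambda>A. measure N1 A - measure N2 A) (sets S)"
      "finite_measure N1" "finite_measure N2" "sets N1 = sets S" "sets N2 = sets S"
      using \<nu> unfolding signed_measures_def by blast
    have "(\<Sum>A\<in>\<D>. \<bar>\<nu> A\<bar>) \<le> measure N1 (space N1) + measure N2 (space N2)"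
      if D: "finite \<D>" "\<D> \<subseteq> sets S" "disjoint \<D>" for \<D>
    proof -
      have "(\<Sum>A\<in>\<D>. \<bar>\<nu> A\<bar>) \<le> (\<Sum>A\<in>\<D>. measure N1 A + measure N2 A)"
      proof (rule sum_mono)
        fix A assume "A \<in> \<D>"
        then have "\<nu> A = measure N1 A - measure N2 A" unfolding N(1) using D(2) by (simp add: subset_iff)
        then show "\<bar>\<nu> A\<bar> \<le> measure N1 A + measure N2 A"
          using measure_nonneg[of N1 A] measure_nonneg[of N2 A] by linarith
      qed
      then show ?thesis using bound[OF N(2,4) D] bound[OF N(3,5) D] by (simp add: sum.distrib)
    qed
    then show ?thesis by blast
  qed
  obtain C1 where C1: "\<forall>\<D>. finite \<D> \<and> \<D> \<subseteq> sets S \<and> disjoint \<D> \<longrightarrow> (\<Sum>A\<in>\<D>. \<bar>\<nu> A\<bar>) \<le> C1"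
    using one[OF assms(1)] by (rule exE)
  obtain C2 where C2: "\<forall>\<D>. finite \<D> \<and> \<D> \<subseteq> sets S \<and> disjoint \<D> \<longrightarrow> (\<Sum>A\<in>\<D>. \<bar>\<rho> A\<bar>) \<le> C2"
    using one[OF assms(2)] by (rule exE)
  have "(\<Sum>A\<in>\<D>. \<bar>\<nu> A - \<rho> A\<bar>) \<le> C1 + C2" if "finite \<D>" "\<D> \<subseteq> sets S" "disjoint \<D>" for \<D>
  proof -
    have "(\<Sum>A\<in>\<D>. \<bar>\<nu> A - \<rho> A\<bar>) \<le> (\<Sum>A\<in>\<D>. \<bar>\<nu> A\<bar> + \<bar>\<rho> A\<bar>)"
      by (intro sum_mono abs_triangle_ineq4)
    then show ?thesis using C1[rule_format, of \<D>] C2[rule_format, of \<D>] that by (simp add: sum.distrib)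
  qed
  then show ?thesis by (intro bdd_aboveI2[where M = "C1 + C2"]) blast
qed

lemma Metric_space_tv_dist: "Metric_space (signed_measures S) (tv_dist S)"
proof -
  define D where "D = {\<D>. finite \<D> \<and> \<D> \<subseteq> sets S \<and> disjoint \<D>}"
  have D: "{} \<in> D" by (simp add: D_def)
  have up: "(\<Sum>A\<in>\<D>. \<bar>\<nu> A - \<rho> A\<bar>) \<le> tv_dist S \<nu> \<rho>"
    if mem: "\<nu> \<in> signed_measures S" "\<rho> \<in> signed_measures S" "\<D> \<in> D" for \<nu> \<rho> \<D>
  proof -
    obtain C where C: "\<And>\<D>. \<D> \<in> D \<Longrightarrow> (\<Sum>A\<in>\<D>. \<bar>\<nu> A - \<rho> A\<bar>) \<le> C"
      using signed_measures_tv_bounded[OF mem(1,2)] by (auto simp: bdd_above_def D_def)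
    have "(SUP \<D>\<in>D. ennreal (\<Sum>A\<in>\<D>. \<bar>\<nu> A - \<rho> A\<bar>)) \<le> ennreal C"
      by (intro SUP_least ennreal_leI C)
    then have fin: "(SUP \<D>\<in>D. ennreal (\<Sum>A\<in>\<D>. \<bar>\<nu> A - \<rho> A\<bar>)) < \<top>"
      using ennreal_less_top order.strict_trans1 by blast
    have "ennreal (\<Sum>A\<in>\<D>. \<bar>\<nu> A - \<rho> A\<bar>) \<le> (SUP \<D>\<in>D. ennreal (\<Sum>A\<in>\<D>. \<bar>\<nu> A - \<rho> A\<bar>))"
      using mem(3) by (rule SUP_upper)
    from enn2real_mono[OF this fin] show ?thesis
      by (simp add: tv_dist_def D_def sum_nonneg)
  qed
  have least: "tv_dist S \<nu> \<rho> \<le> c"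
    if "\<And>\<D>. \<D> \<in> D \<Longrightarrow> (\<Sum>A\<in>\<D>. \<bar>\<nu> A - \<rho> A\<bar>) \<le> c" for \<nu> \<rho> c
  proof -
    have c: "0 \<le> c" using that[OF D] by simp
    have "(SUP \<D>\<in>D. ennreal (\<Sum>A\<in>\<D>. \<bar>\<nu> A - \<rho> A\<bar>)) \<le> ennreal c"
      by (intro SUP_least ennreal_leI that)
    then show ?thesis
      using c enn2real_leI unfolding tv_dist_def D_def by blast
  qed
  show ?thesis
  proof
    show "0 \<le> tv_dist S \<nu> \<rho>" for \<nu> \<rho> by (simp add: tv_dist_def)
    show "tv_dist S \<nu> \<rho> = tv_dist S \<rho> \<nu>" for \<nu> \<rho>
      by (simp add: tv_dist_def abs_minus_commute)
    show "(tv_dist S \<nu> \<rho> = 0) = (\<nu> = \<rho>)"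
      if s: "\<nu> \<in> signed_measures S" "\<rho> \<in> signed_measures S" for \<nu> \<rho>
    proof
      assume z: "tv_dist S \<nu> \<rho> = 0"
      show "\<nu> = \<rho>"
      proof
        fix A
        show "\<nu> A = \<rho> A"
        proof (cases "A \<in> sets S")
          case True
          then have "{A} \<in> D" by (simp add: D_def)
          from up[OF s this] z show ?thesis by simp
        next
          case False
          have "\<tau> A = undefined" if \<tau>: "\<tau> \<in> signed_measures S" for \<tau>
          proof -
            obtain N1 N2 where "\<tau> = restrict (\<lambda>A. measure N1 A - measure N2 A) (sets S)"
              using \<tau> unfolding signed_measures_def by blast
            with False show ?thesis by simp
          qed
          then have "\<nu> A = undefined" "\<rho> A = undefined" using s by blast+
          then show ?thesis by (rule trans[OF _ sym])
        qed
      qed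
    next
      assume "\<nu> = \<rho>"
      then have "tv_dist S \<nu> \<rho> \<le> 0" by (intro least) simp
      then show "tv_dist S \<nu> \<rho> = 0" by (simp add: tv_dist_def order.antisym)
    qed
    show "tv_dist S \<nu> \<tau> \<le> tv_dist S \<nu> \<rho> + tv_dist S \<rho> \<tau>"
      if s: "\<nu> \<in> signed_measures S" "\<rho> \<in> signed_measures S" "\<tau> \<in> signed_measures S" for \<nu> \<rho> \<tau>
    proof (rule least)
      fix \<D> assume "\<D> \<in> D"
      have "(\<Sum>A\<in>\<D>. \<bar>\<nu> A - \<tau> A\<bar>) \<le> (\<Sum>A\<in>\<D>. \<bar>\<nu> A - \<rho> A\<bar> + \<bar>\<rho> A - \<tau> A\<bar>)"
        by (intro sum_mono) linarith
      also have "\<dots> \<le> tv_dist S \<nu> \<rho> + tv_dist S \<rho> \<tau>"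
        using up[OF s(1,2) \<open>\<D> \<in> D\<close>] up[OF s(2,3) \<open>\<D> \<in> D\<close>] by (simp add: sum.distrib)
      finally show "(\<Sum>A\<in>\<D>. \<bar>\<nu> A - \<tau> A\<bar>) \<le> tv_dist S \<nu> \<rho> + tv_dist S \<rho> \<tau>" .
    qed
  qed
qed

lemma L1_space_signed:
  assumes "sets \<mu> = sets S"
  shows "L1_space \<mu> \<subseteq> signed_measures S"
proof
  fix \<nu> assume "\<nu> \<in> L1_space \<mu>"
  then obtain f where f: "integrable \<mu> f" and \<nu>: "\<nu> = restrict (\<lambda>A. set_lebesgue_integral \<mu> A f) (sets \<mu>)"
    by (auto simp: L1_space_def)
  have key: "finite_measure (density \<mu> (\<lambda>x. ennreal (max 0 (g x))))
     \<and> (\<forall>A\<in>sets \<mu>. measure (density \<mu> (\<lambda>x. ennreal (max 0 (g x)))) A = (\<integral>x. indicator A x * max 0 (g x) \<partial>\<mu>))"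
    if g: "integrable \<mu> g" for g
  proof -
    have i: "integrable \<mu> (\<lambda>x. max 0 (g x))" using g by auto
    have e: "emeasure (density \<mu> (\<lambda>x. ennreal (max 0 (g x)))) A = ennreal (\<integral>x. indicator A x * max 0 (g x) \<partial>\<mu>)"
      if A: "A \<in> sets \<mu>" for A
    proof -
      have "emeasure (density \<mu> (\<lambda>x. ennreal (max 0 (g x)))) A
         = (\<integral>\<^sup>+x. ennreal (max 0 (g x)) * indicator A x \<partial>\<mu>)"
        using g A by (intro emeasure_density) auto
      also have "\<dots> = (\<integral>\<^sup>+x. ennreal (indicator A x * max 0 (g x)) \<partial>\<mu>)"
        by (intro nn_integral_cong) (auto simp: indicator_def)
      also have "\<dots> = ennreal (\<integral>x. indicator A x * max 0 (g x) \<partial>\<mu>)"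
        using integrable_mult_indicator[OF A i] by (intro nn_integral_eq_integral) auto
      finally show ?thesis .
    qed
    have nn: "0 \<le> (\<integral>x. indicator A x * max 0 (g x) \<partial>\<mu>)" for A
      by (rule Bochner_Integration.integral_nonneg) (simp add: indicator_def)
    show ?thesis
    proof (intro conjI ballI)
      show "finite_measure (density \<mu> (\<lambda>x. ennreal (max 0 (g x))))"
        by (rule finite_measureI) (simp only: space_density e[OF sets.top] infinity_ennreal_def ennreal_neq_top not_False_eq_True)
      show "measure (density \<mu> (\<lambda>x. ennreal (max 0 (g x)))) A = (\<integral>x. indicator A x * max 0 (g x) \<partial>\<mu>)"
        if "A \<in> sets \<mu>" for A
        by (simp only: measure_def e[OF that] enn2real_ennreal[OF nn])
    qed
  qed
  have ex: "\<exists>N. finite_measure N \<and> sets N = sets \<mu> \<and> (\<forall>A\<in>sets \<mu>. measure N A = (\<integral>x. indicator A x * max 0 (g x) \<partial>\<mu>))"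
    if "integrable \<mu> g" for g
    using key[OF that] sets_density by blast
  obtain N1 where N1: "finite_measure N1" "sets N1 = sets \<mu>"
      "\<And>A. A \<in> sets \<mu> \<Longrightarrow> measure N1 A = (\<integral>x. indicator A x * max 0 (f x) \<partial>\<mu>)"
    using ex[OF f] by blast
  obtain N2 where N2: "finite_measure N2" "sets N2 = sets \<mu>"
      "\<And>A. A \<in> sets \<mu> \<Longrightarrow> measure N2 A = (\<integral>x. indicator A x * max 0 (- f x) \<partial>\<mu>)"
    using ex[OF Bochner_Integration.integrable_minus[OF f]] by blast
  have eq: "set_lebesgue_integral \<mu> A f = measure N1 A - measure N2 A" if A: "A \<in> sets \<mu>" for A
  proof -
    have i: "integrable \<mu> (\<lambda>x. indicator A x * max 0 (f x))" "integrable \<mu> (\<lambda>x. indicator A x * max 0 (- f x))"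
      using integrable_mult_indicator[OF A, of "\<lambda>x. max 0 (f x)"]
        integrable_mult_indicator[OF A, of "\<lambda>x. max 0 (- f x)"] f by simp_all
    have "measure N1 A - measure N2 A
       = (\<integral>x. indicator A x * max 0 (f x) - indicator A x * max 0 (- f x) \<partial>\<mu>)"
      unfolding N1(3)[OF A] N2(3)[OF A] by (rule Bochner_Integration.integral_diff[OF i, symmetric])
    also have "\<dots> = set_lebesgue_integral \<mu> A f"
      unfolding set_lebesgue_integral_def
      by (intro Bochner_Integration.integral_cong) (auto simp: indicator_def max_def)
    finally show ?thesis by simp
  qed
  have "\<nu> = restrict (\<lambda>A. measure N1 A - measure N2 A) (sets \<mu>)"
    unfolding \<nu> using eq by (rule restrict_ext)
  then show "\<nu> \<in> signed_measures S"
    using N1(1,2) N2(1,2) unfolding signed_measures_def assms by blast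
qed

lemma empirical_signed:
  assumes "finite_sample S \<Omega> n X" "\<omega> \<in> space \<Omega>"
  shows "empirical_distribution S n X \<omega> \<in> signed_measures S"
proof -
  let ?N1 = "distr (uniform_count_measure {..<n}) S (\<lambda>i. X i \<omega>)" and ?N2 = "null_measure S"
  have m: "(\<lambda>i. X i \<omega>) \<in> measurable (uniform_count_measure {..<n}) S"
    using assms by (auto simp: finite_sample_def measurable_def space_uniform_count_measure sets_uniform_count_measure)
  have "prob_space (uniform_count_measure {..<n})"
    using assms by (intro prob_space_uniform_count_measure) (auto simp: finite_sample_def)
  then have f: "finite_measure ?N1"
    using m prob_space.prob_space_distr prob_space.finite_measure by blast
  have "measure ?N1 A = real (card {i\<in>{..<n}. X i \<omega> \<in> A}) / real n" if "A \<in> sets S" for A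
  proof -
    have *: "(\<lambda>i. X i \<omega>) -` A \<inter> {..<n} = {i\<in>{..<n}. X i \<omega> \<in> A}" by auto
    show ?thesis
      using m that by (simp add: measure_distr space_uniform_count_measure * )
        (subst measure_uniform_count_measure, auto)
  qed
  then show ?thesis
    unfolding signed_measures_def empirical_distribution_def
    by (intro CollectI exI[of _ ?N1] exI[of _ ?N2])
      (use f in \<open>auto simp: restrict_def fun_eq_iff intro!: finite_measureI\<close>)
qed

lemma L1_X_signed:
  assumes "sets \<mu> = sets S" "finite_sample S \<Omega> n X"
  shows "L1_X S \<mu> \<Omega> n X \<subseteq> signed_measures S"
proof -
  have I: "restrict g (sets S) \<in> signed_measures S"
    if "finite_measure N1" "finite_measure N2" "sets N1 = sets S" "sets N2 = sets S"
      "\<And>A. A \<in> sets S \<Longrightarrow> g A = measure N1 A - measure N2 A" for g N1 N2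
  proof -
    have "restrict g (sets S) = restrict (\<lambda>A. measure N1 A - measure N2 A) (sets S)"
      by (rule restrict_ext) (rule that(5))
    then show ?thesis
      unfolding signed_measures_def
      by (intro CollectI exI[of _ N1] exI[of _ N2] conjI that(1-4))
  qed
  have z: "(\<lambda>A\<in>sets S. 0) \<in> signed_measures S"
    by (rule I[of "null_measure S" "null_measure S"]) (auto intro!: finite_measureI)
  have dest: "\<exists>N1 N2. finite_measure N1 \<and> finite_measure N2 \<and> sets N1 = sets S \<and> sets N2 = sets S
        \<and> (\<forall>A\<in>sets S. \<nu> A = measure N1 A - measure N2 A)" if \<nu>: "\<nu> \<in> signed_measures S" for \<nu>
  proof -
    obtain N1 N2 where N: "\<nu> = restrict (\<lambda>A. measure N1 A - measure N2 A) (sets S)"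
      "finite_measure N1" "finite_measure N2" "sets N1 = sets S" "sets N2 = sets S"
      using \<nu> unfolding signed_measures_def by blast
    have "\<forall>A\<in>sets S. \<nu> A = measure N1 A - measure N2 A" unfolding N(1) by simp
    with N(2-5) show ?thesis by blast
  qed
  have sc: "finite_measure (scale_measure (ennreal c) N) \<and> (\<forall>A. measure (scale_measure (ennreal c) N) A = c * measure N A)"
    if "finite_measure N" "0 \<le> c" for c N
    using that by (auto intro!: finite_measureI simp: space_scale_measure ennreal_mult_eq_top_iff finite_measure.emeasure_finite
       measure_def enn2real_mult)
  have s: "(\<lambda>A\<in>sets S. c * \<nu> A) \<in> signed_measures S" if \<nu>: "\<nu> \<in> signed_measures S" for c \<nu>
  proof -
    obtain N1 N2 where N: "finite_measure N1" "finite_measure N2" "sets N1 = sets S" "sets N2 = sets S"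
      "\<forall>A\<in>sets S. \<nu> A = measure N1 A - measure N2 A" using dest[OF \<nu>] by blast
    show ?thesis
    proof (cases "0 \<le> c")
      case True
      show ?thesis
        by (rule I[of "scale_measure (ennreal c) N1" "scale_measure (ennreal c) N2"])
          (simp_all add: N sc[OF N(1) True] sc[OF N(2) True] right_diff_distrib)
    next
      case False
      then have c: "0 \<le> - c" by simp
      show ?thesis
        by (rule I[of "scale_measure (ennreal (-c)) N2" "scale_measure (ennreal (-c)) N1"])
          (simp_all add: N sc[OF N(1) c] sc[OF N(2) c] right_diff_distrib)
    qed
  qed
  have addm: "\<exists>N. finite_measure N \<and> sets N = sets S \<and> (\<forall>A\<in>sets S. measure N A = measure N1 A + measure N2 A)"
    if N: "finite_measure N1" "finite_measure N2" "sets N1 = sets S" "sets N2 = sets S" for N1 N2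
  proof -
    interpret N1: finite_measure N1 by fact
    interpret N2: finite_measure N2 by fact
    define N where "N = measure_of (space S) (sets S) (\<lambda>A. emeasure N1 A + emeasure N2 A)"
    have e: "emeasure N A = emeasure N1 A + emeasure N2 A" if "A \<in> sets S" for A
    proof (rule emeasure_measure_of[OF N_def])
      show "countably_additive (sets N) (\<lambda>A. emeasure N1 A + emeasure N2 A)"
      proof (rule countably_additiveI)
        fix F :: "nat \<Rightarrow> 'a set" assume F: "range F \<subseteq> sets N" "disjoint_family F"
        have "range F \<subseteq> sets N1" "range F \<subseteq> sets N2" using F N by (auto simp: N_def)
        then show "(\<Sum>i. emeasure N1 (F i) + emeasure N2 (F i)) = emeasure N1 (\<Union>(range F)) + emeasure N2 (\<Union>(range F))"
          using F by (simp add: suminf_add[symmetric] suminf_emeasure)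
      qed
    qed (use that sets.space_closed in \<open>auto simp: N_def positive_def\<close>)
    have sN: "sets N = sets S" "space N = space S" by (auto simp: N_def)
    have "finite_measure N" using e[OF sets.top] sN by (intro finite_measureI) auto
    moreover have "measure N A = measure N1 A + measure N2 A" if "A \<in> sets S" for A
      using e[OF that] by (simp add: measure_def enn2real_plus N1.emeasure_finite N2.emeasure_finite top.not_eq_extremum[symmetric])
    ultimately show ?thesis using sN by blast
  qed
  have a: "(\<lambda>A\<in>sets S. \<nu> A + \<rho> A) \<in> signed_measures S"
    if \<nu>: "\<nu> \<in> signed_measures S" and \<rho>: "\<rho> \<in> signed_measures S" for \<nu> \<rho>
  proof -
    obtain N1 N2 where N: "finite_measure N1" "finite_measure N2" "sets N1 = sets S" "sets N2 = sets S"
      "\<forall>A\<in>sets S. \<nu> A = measure N1 A - measure N2 A" using dest[OF \<nu>] by blast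
    obtain M1 M2 where M: "finite_measure M1" "finite_measure M2" "sets M1 = sets S" "sets M2 = sets S"
      "\<forall>A\<in>sets S. \<rho> A = measure M1 A - measure M2 A" using dest[OF \<rho>] by blast
    obtain K1 where K1: "finite_measure K1" "sets K1 = sets S" "\<forall>A\<in>sets S. measure K1 A = measure N1 A + measure M1 A"
      using addm[OF N(1) M(1) N(3) M(3)] by blast
    obtain K2 where K2: "finite_measure K2" "sets K2 = sets S" "\<forall>A\<in>sets S. measure K2 A = measure N2 A + measure M2 A"
      using addm[OF N(2) M(2) N(4) M(4)] by blast
    show ?thesis
      by (rule I[of K1 K2]) (simp_all add: N(5) M(5) K1 K2)
  qed
  have "L1_subspace S (signed_measures S)"
    unfolding L1_subspace_def using a s z by blast
  moreover have "empirical_distribution S n X ` space \<Omega> \<subseteq> signed_measures S"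
    using empirical_signed[OF assms(2)] by blast
  ultimately show ?thesis
    using L1_space_signed[OF assms(1)] unfolding L1_X_def by blast
qed

lemma Metric_space_L1_X:
  assumes "continuous_model S \<mu> \<M>" "finite_sample S \<Omega> n X"
  shows "Metric_space (L1_X S \<mu> \<Omega> n X) (tv_dist S)"
  using Metric_space.subspace[OF Metric_space_tv_dist L1_X_signed] assms
  by (auto simp: continuous_model_def)


section \<open>Topologies on the model that make an estimand continuous\<close>

text \<open>
  The map \<open>\<iota>\<close> is the identification through which the function \<open>\<epsilon>(P | X)\<close> on \<open>\<A>\<^sup>n\<close> is regarded
  as an element of \<open>L\<^sup>1\<^sub>X(S, \<Sigma>)\<close>. No particular identification is singled out: a real function on
  events of \<open>\<Omega>\<close> has no canonical representative among the signed measures on \<open>(S, \<Sigma>)\<close>.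
\<close>

definition makes_continuous ::
  "'a measure \<Rightarrow> 'a measure \<Rightarrow> 'a measure set \<Rightarrow> 'w measure \<Rightarrow> nat \<Rightarrow> (nat \<Rightarrow> 'w \<Rightarrow> 'a) \<Rightarrow>
   (('w set \<Rightarrow> real) \<Rightarrow> ('a set \<Rightarrow> real)) \<Rightarrow> ('a measure \<Rightarrow> 'w set \<Rightarrow> real) \<Rightarrow>
   'a measure topology \<Rightarrow> bool" where
  "makes_continuous S \<mu> \<M> \<Omega> n X \<iota> \<epsilon> T \<longleftrightarrow>
     topspace T = \<M> \<and>
     continuous_map T (L1_X_topology S \<mu> \<Omega> n X) (\<lambda>P. \<iota> (estimand_fun S \<Omega> n X \<epsilon> P))"

definition coarser :: "'a topology \<Rightarrow> 'a topology \<Rightarrow> bool" where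
  "coarser T T' \<longleftrightarrow> (\<forall>U. openin T U \<longrightarrow> openin T' U)"

definition coarsest :: "('a topology \<Rightarrow> bool) \<Rightarrow> 'a topology \<Rightarrow> bool" where
  "coarsest \<Phi> T \<longleftrightarrow> \<Phi> T \<and> (\<forall>T'. \<Phi> T' \<longrightarrow> coarser T T')"

end

theory Submission
  imports Defs
begin

text \<open>
  The coarsest topology is the initial topology of \<open>P \<mapsto> \<epsilon>(P | X)\<close>: its open sets are the
  preimages of the open subsets of \<open>L\<^sup>1\<^sub>X(S, \<Sigma>)\<close>. Continuity forces all these preimages to be open,
  and they already form a topology. The underlying set of this topology is all of \<open>\<M>\<close> because
  the map sends \<open>\<M>\<close> into \<open>L\<^sup>1\<^sub>X(S, \<Sigma>)\<close>, which is the whole underlying set of its metric topology.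
  A coarsest topology is unique because two topologies that are coarser than each other have
  the same open sets.
\<close>

lemma coarser_antisym:
  assumes "coarser T T'" "coarser T' T"
  shows "T = T'"
  using assms by (auto simp: coarser_def topology_eq)

lemma coarsest_unique:
  assumes "coarsest \<Phi> T" "coarsest \<Phi> T'"
  shows "T = T'"
  using assms by (auto simp: coarsest_def intro: coarser_antisym)

lemma coarsest_pullback_topology:
  assumes f: "f \<in> M \<rightarrow> topspace Y"
  shows "coarsest (\<lambda>T. topspace T = M \<and> continuous_map T Y f) (pullback_topology M f Y)"
  unfolding coarsest_def
proof (intro conjI allI impI)
  show top: "topspace (pullback_topology M f Y) = M"
    using f by (auto simp: topspace_pullback_topology)
  show "continuous_map (pullback_topology M f Y) Y f"
    using continuous_map_pullback[OF continuous_map_id, of M f Y] by simp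
  fix T assume T: "topspace T = M \<and> continuous_map T Y f"
  show "coarser (pullback_topology M f Y) T"
    unfolding coarser_def openin_pullback_topology
  proof (intro allI impI, elim exE conjE)
    fix U V assume V: "openin Y V" and U: "U = f -` V \<inter> M"
    have "U = {x \<in> topspace T. f x \<in> V}" using T U by auto
    with openin_continuous_map_preimage[of T Y f V] T V show "openin T U" by simp
  qed
qed

theorem theorem13:
  fixes S \<mu> :: "'a measure"
    and \<M> :: "'a measure set"
    and \<Omega> :: "'w measure"
    and n :: nat
    and X :: "nat \<Rightarrow> 'w \<Rightarrow> 'a"
    and \<epsilon> :: "'a measure \<Rightarrow> 'w set \<Rightarrow> real"
    and \<iota> :: "('w set \<Rightarrow> real) \<Rightarrow> ('a set \<Rightarrow> real)"
  assumes "continuous_model S \<mu> \<M>"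
    and "finite_sample S \<Omega> n X"
    and "estimand S \<mu> \<M> \<Omega> n X \<epsilon>"
    and "\<And>P. P \<in> \<M> \<Longrightarrow> \<iota> (estimand_fun S \<Omega> n X \<epsilon> P) \<in> L1_X S \<mu> \<Omega> n X"
  shows "\<exists>!T. coarsest (makes_continuous S \<mu> \<M> \<Omega> n X \<iota> \<epsilon>) T"
proof -
  let ?Y = "L1_X_topology S \<mu> \<Omega> n X"
  let ?f = "\<lambda>P. \<iota> (estimand_fun S \<Omega> n X \<epsilon> P)"
  have "topspace ?Y = L1_X S \<mu> \<Omega> n X"
    unfolding L1_X_topology_def
    by (rule Metric_space.topspace_mtopology[OF Metric_space_L1_X[OF assms(1,2)]])
  then have "?f \<in> \<M> \<rightarrow> topspace ?Y"
    using assms(4) by auto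
  then have "coarsest (makes_continuous S \<mu> \<M> \<Omega> n X \<iota> \<epsilon>) (pullback_topology \<M> ?f ?Y)"
    unfolding makes_continuous_def[abs_def] by (rule coarsest_pullback_topology)
  then show ?thesis
    using coarsest_unique by blast
qed

end
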